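(* The functor $\widetilde{\mathfrak{C}}:\mathbf{isSet}\to\mathbf{isCat}$ is left adjoint to the functor $\widetilde{N}_{hc}:\mathbf{isCat}\to\mathbf{isSet}$.
   Context: $\mathbf{sSet}$ is the category of simplicial sets and $\mathbf{sCat}$ the category of small simplicially enriched categories. For $X\in\mathbf{sCat}$, $X^{\mathrm{op}}$ has the same objects and $X^{\mathrm{op}}(a,b)=X(b,a)$; for $A\in\mathbf{sSet}$, $A^{\mathrm{op}}$ is the precomposition of $A$ with the order-reversing automorphism of $\Delta$. An object of $\mathbf{isCat}$ (resp. $\mathbf{isSet}$) is an object $X$ of $\mathbf{sCat}$ (resp. $\mathbf{sSet}$) together with a morphism $\tau:X^{\mathrm{op}}\to X$ satisfying $\tau^{\mathrm{op}}\tau=\mathrm{id}_{X^{\mathrm{op}}}$ (an anti-involution); a morphism $(X,\tau)\to(X',\tau')$ is a morphism $f:X\to X'$ of $\mathbf{sCat}$ (resp. $\mathbf{sSet}$) with $\tau' f^{\mathrm{op}}=f\tau$. $\mathfrak{C}:\mathbf{sSet}\rightleftarrows\mathbf{sCat}:N_{hc}$ is the adjunction of homotopy coherent realization $\mathfrak{C}$ (left adjoint, with $\mathfrak{C}(\Delta^n)$ having objects $0,\dots,n$ and $\mathfrak{C}(\Delta^n)(i,j)$ the nerve of the poset of subsets of $\{i,\dots,j\}$ containing $i$ and $j$ when $i\le j$, and empty otherwise) and homotopy coherent nerve $N_{hc}$, with unit $\eta$ and counit $\varepsilon$. Fix natural isomorphisms $z_X:(N_{hc}X)^{\mathrm{op}}\to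 N_{hc}(X^{\mathrm{op}})$ and $w_A:(\mathfrak{C}A)^{\mathrm{op}}\to\mathfrak{C}(A^{\mathrm{op}})$ such that $z_X^{-1}=(z_{X^{\mathrm{op}}})^{\mathrm{op}}$, $w_A^{-1}=(w_{A^{\mathrm{op}}})^{\mathrm{op}}$ and $w_A^{-1}=\varepsilon_{(\mathfrak{C}A)^{\mathrm{op}}}\circ\mathfrak{C}(z_{\mathfrak{C}A})\circ\mathfrak{C}((\eta_A)^{\mathrm{op}})$ (such isomorphisms exist). Define $\widetilde{\mathfrak{C}}(A,\sigma)=(\mathfrak{C}(A),\mathfrak{C}(\sigma)\circ w_A)$ and $\widetilde{N}_{hc}(X,\tau)=(N_{hc}(X),N_{hc}(\tau)\circ z_X)$, acting on morphisms as $\mathfrak{C}$ and $N_{hc}$; the displayed maps are again anti-involutions. *)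

theory Defs
  imports Main "HOL-Library.FuncSet"
begin

section \<open>Categories, functors, adjunctions\<close>

record ('o, 'm) cat =
  Obj :: "'o set"
  Hom :: "'o \<Rightarrow> 'o \<Rightarrow> 'm set"
  Id :: "'o \<Rightarrow> 'm"
  Comp :: "'m \<Rightarrow> 'm \<Rightarrow> 'm"

definition category :: "('o, 'm) cat \<Rightarrow> bool" where
  "category C \<longleftrightarrow>
     (\<forall>X\<in>Obj C. Id C X \<in> Hom C X X) \<and>
     (\<forall>X\<in>Obj C. \<forall>Y\<in>Obj C. \<forall>Z\<in>Obj C. \<forall>f\<in>Hom C X Y. \<forall>g\<in>Hom C Y Z. Comp C g f \<in> Hom C X Z) \<and>
     (\<forall>X\<in>Obj C. \<forall>Y\<in>Obj C. \<forall>f\<in>Hom C X Y. Comp C (Id C Y) f = f \<and> Comp C f (Id C X) = f) \<and>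
     (\<forall>W\<in>Obj C. \<forall>X\<in>Obj C. \<forall>Y\<in>Obj C. \<forall>Z\<in>Obj C.
        \<forall>f\<in>Hom C W X. \<forall>g\<in>Hom C X Y. \<forall>h\<in>Hom C Y Z.
          Comp C h (Comp C g f) = Comp C (Comp C h g) f)"

record ('o, 'm, 'p, 'n) ftr =
  on_obj :: "'o \<Rightarrow> 'p"
  on_arr :: "'m \<Rightarrow> 'n"

definition is_functor :: "('o, 'm) cat \<Rightarrow> ('p, 'n) cat \<Rightarrow> ('o, 'm, 'p, 'n) ftr \<Rightarrow> bool" where
  "is_functor C D F \<longleftrightarrow> category C \<and> category D \<and>
     (\<forall>X\<in>Obj C. on_obj F X \<in> Obj D) \<and>
     (\<forall>X\<in>Obj C. \<forall>Y\<in>Obj C. \<forall>f\<in>Hom C X Y. on_arr F f \<in> Hom D (on_obj F X) (on_obj F Y)) \<and>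
     (\<forall>X\<in>Obj C. on_arr F (Id C X) = Id D (on_obj F X)) \<and>
     (\<forall>X\<in>Obj C. \<forall>Y\<in>Obj C. \<forall>Z\<in>Obj C. \<forall>f\<in>Hom C X Y. \<forall>g\<in>Hom C Y Z.
        on_arr F (Comp C g f) = Comp D (on_arr F g) (on_arr F f))"

definition id_ftr :: "('o, 'm, 'o, 'm) ftr" where
  "id_ftr = \<lparr>on_obj = id, on_arr = id\<rparr>"

definition comp_ftr ::
  "('p, 'n, 'q, 'k) ftr \<Rightarrow> ('o, 'm, 'p, 'n) ftr \<Rightarrow> ('o, 'm, 'q, 'k) ftr"  (infixl "\<circ>\<^sub>F" 55) where
  "G \<circ>\<^sub>F F = \<lparr>on_obj = on_obj G \<circ> on_obj F, on_arr = on_arr G \<circ> on_arr F\<rparr>"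

definition natural_transformation ::
  "('o, 'm) cat \<Rightarrow> ('p, 'n) cat \<Rightarrow> ('o, 'm, 'p, 'n) ftr \<Rightarrow> ('o, 'm, 'p, 'n) ftr \<Rightarrow> ('o \<Rightarrow> 'n) \<Rightarrow> bool" where
  "natural_transformation C D F G \<alpha> \<longleftrightarrow> is_functor C D F \<and> is_functor C D G \<and>
     (\<forall>X\<in>Obj C. \<alpha> X \<in> Hom D (on_obj F X) (on_obj G X)) \<and>
     (\<forall>X\<in>Obj C. \<forall>Y\<in>Obj C. \<forall>f\<in>Hom C X Y.
        Comp D (\<alpha> Y) (on_arr F f) = Comp D (on_arr G f) (\<alpha> X))"

definition inverse_arrows :: "('o, 'm) cat \<Rightarrow> 'o \<Rightarrow> 'o \<Rightarrow> 'm \<Rightarrow> 'm \<Rightarrow> bool" where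
  "inverse_arrows C X Y f g \<longleftrightarrow> f \<in> Hom C X Y \<and> g \<in> Hom C Y X \<and>
     Comp C g f = Id C X \<and> Comp C f g = Id C Y"

definition natural_isomorphism ::
  "('o, 'm) cat \<Rightarrow> ('p, 'n) cat \<Rightarrow> ('o, 'm, 'p, 'n) ftr \<Rightarrow> ('o, 'm, 'p, 'n) ftr \<Rightarrow> ('o \<Rightarrow> 'n) \<Rightarrow> bool" where
  "natural_isomorphism C D F G \<alpha> \<longleftrightarrow> natural_transformation C D F G \<alpha> \<and>
     (\<forall>X\<in>Obj C. \<exists>g. inverse_arrows D (on_obj F X) (on_obj G X) (\<alpha> X) g)"

definition adjunction ::
  "('o, 'm) cat \<Rightarrow> ('p, 'n) cat \<Rightarrow> ('o, 'm, 'p, 'n) ftr \<Rightarrow> ('p, 'n, 'o, 'm) ftr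
     \<Rightarrow> ('o \<Rightarrow> 'm) \<Rightarrow> ('p \<Rightarrow> 'n) \<Rightarrow> bool" where
  "adjunction C D F G \<eta> \<epsilon> \<longleftrightarrow> is_functor C D F \<and> is_functor D C G \<and>
     natural_transformation C C id_ftr (G \<circ>\<^sub>F F) \<eta> \<and>
     natural_transformation D D (F \<circ>\<^sub>F G) id_ftr \<epsilon> \<and>
     (\<forall>X\<in>Obj C. Comp D (\<epsilon> (on_obj F X)) (on_arr F (\<eta> X)) = Id D (on_obj F X)) \<and>
     (\<forall>Y\<in>Obj D. Comp C (on_arr G (\<epsilon> Y)) (\<eta> (on_obj G Y)) = Id C (on_obj G Y))"

definition left_adjoint ::
  "('o, 'm) cat \<Rightarrow> ('p, 'n) cat \<Rightarrow> ('o, 'm, 'p, 'n) ftr \<Rightarrow> ('p, 'n, 'o, 'm) ftr \<Rightarrow> bool" where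
  "left_adjoint C D F G \<longleftrightarrow> (\<exists>\<eta> \<epsilon>. adjunction C D F G \<eta> \<epsilon>)"


section \<open>Simplicial sets\<close>

text \<open>\<open>Delta m n\<close> is the set of monotone maps \<open>[m] \<rightarrow> [n]\<close>, where \<open>[n] = {0, \<dots>, n}\<close>.\<close>

definition Delta :: "nat \<Rightarrow> nat \<Rightarrow> (nat \<Rightarrow> nat) set" where
  "Delta m n = {\<theta> \<in> {..m} \<rightarrow>\<^sub>E {..n}. mono_on {..m} \<theta>}"

text \<open>The order-reversing automorphism of \<open>\<Delta>\<close>.\<close>

definition rev_Delta :: "nat \<Rightarrow> nat \<Rightarrow> (nat \<Rightarrow> nat) \<Rightarrow> (nat \<Rightarrow> nat)" where
  "rev_Delta m n \<theta> = (\<lambda>i\<in>{..m}. n - \<theta> (m - i))"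

text \<open>\<open>act K m n \<theta> : K\<^sub>n \<rightarrow> K\<^sub>m\<close> is the action of \<open>\<theta> : [m] \<rightarrow> [n]\<close>.\<close>

record 's sset =
  simp :: "nat \<Rightarrow> 's set"
  act :: "nat \<Rightarrow> nat \<Rightarrow> (nat \<Rightarrow> nat) \<Rightarrow> 's \<Rightarrow> 's"

text \<open>The value of \<open>act\<close> off \<open>Delta\<close> is fixed so that \<open>(A\<^sup>o\<^sup>p)\<^sup>o\<^sup>p = A\<close> holds as an equation of records.\<close>

definition is_sset :: "'s sset \<Rightarrow> bool" where
  "is_sset K \<longleftrightarrow>
     (\<forall>m n. \<forall>\<theta>\<in>Delta m n. act K m n \<theta> \<in> simp K n \<rightarrow>\<^sub>E simp K m) \<and>
     (\<forall>m n \<theta>. \<theta> \<notin> Delta m n \<longrightarrow> act K m n \<theta> = undefined) \<and>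
     (\<forall>n. \<forall>x\<in>simp K n. act K n n (\<lambda>i\<in>{..n}. i) x = x) \<and>
     (\<forall>l m n. \<forall>\<phi>\<in>Delta l m. \<forall>\<theta>\<in>Delta m n. \<forall>x\<in>simp K n.
        act K l n (compose {..l} \<theta> \<phi>) x = act K l m \<phi> (act K m n \<theta> x))"

definition is_sset_map :: "'s sset \<Rightarrow> 't sset \<Rightarrow> (nat \<Rightarrow> 's \<Rightarrow> 't) \<Rightarrow> bool" where
  "is_sset_map K L f \<longleftrightarrow>
     (\<forall>n. f n \<in> simp K n \<rightarrow>\<^sub>E simp L n) \<and>
     (\<forall>m n. \<forall>\<theta>\<in>Delta m n. \<forall>x\<in>simp K n. f m (act K m n \<theta> x) = act L m n \<theta> (f n x))"

text \<open>Arrows carry their source and target.\<close>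

type_synonym 's sset_arr = "'s sset \<times> 's sset \<times> (nat \<Rightarrow> 's \<Rightarrow> 's)"

definition sSet :: "('s sset, 's sset_arr) cat" where
  "sSet = \<lparr>Obj = {K. is_sset K},
           Hom = (\<lambda>K L. {(K, L, f) | f. is_sset_map K L f}),
           Id = (\<lambda>K. (K, K, \<lambda>n. \<lambda>x\<in>simp K n. x)),
           Comp = (\<lambda>(_, M, g) (K, _, f). (K, M, \<lambda>n. compose (simp K n) (g n) (f n)))\<rparr>"

definition op_sset :: "'s sset \<Rightarrow> 's sset" where
  "op_sset K = \<lparr>simp = simp K,
                act = (\<lambda>m n \<theta>. if \<theta> \<in> Delta m n then act K m n (rev_Delta m n \<theta>) else undefined)\<rparr>"

definition op_sSet :: "('s sset, 's sset_arr, 's sset, 's sset_arr) ftr" where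
  "op_sSet = \<lparr>on_obj = op_sset, on_arr = (\<lambda>(K, L, f). (op_sset K, op_sset L, f))\<rparr>"


section \<open>Simplicially enriched categories\<close>

text \<open>\<open>cmp X a b c n : X(b,c)\<^sub>n \<times> X(a,b)\<^sub>n \<rightarrow> X(a,c)\<^sub>n\<close>; the identities are vertices.\<close>

record ('o, 'h) scat =
  ob :: "'o set"
  hom :: "'o \<Rightarrow> 'o \<Rightarrow> 'h sset"
  idn :: "'o \<Rightarrow> 'h"
  cmp :: "'o \<Rightarrow> 'o \<Rightarrow> 'o \<Rightarrow> nat \<Rightarrow> 'h \<Rightarrow> 'h \<Rightarrow> 'h"

definition idn_at :: "('o, 'h) scat \<Rightarrow> nat \<Rightarrow> 'o \<Rightarrow> 'h" where
  "idn_at X n a = act (hom X a a) n 0 (\<lambda>i\<in>{..n}. 0) (idn X a)"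

definition is_scat :: "('o, 'h) scat \<Rightarrow> bool" where
  "is_scat X \<longleftrightarrow>
     (\<forall>a\<in>ob X. \<forall>b\<in>ob X. is_sset (hom X a b)) \<and>
     (\<forall>a\<in>ob X. idn X a \<in> simp (hom X a a) 0) \<and>
     (\<forall>a\<in>ob X. \<forall>b\<in>ob X. \<forall>c\<in>ob X. \<forall>n. \<forall>g\<in>simp (hom X b c) n. \<forall>f\<in>simp (hom X a b) n.
        cmp X a b c n g f \<in> simp (hom X a c) n \<and>
        (\<forall>m. \<forall>\<theta>\<in>Delta m n. act (hom X a c) m n \<theta> (cmp X a b c n g f) =
           cmp X a b c m (act (hom X b c) m n \<theta> g) (act (hom X a b) m n \<theta> f))) \<and>
     (\<forall>a\<in>ob X. \<forall>b\<in>ob X. \<forall>n. \<forall>f\<in>simp (hom X a b) n.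
        cmp X a b b n (idn_at X n b) f = f \<and> cmp X a a b n f (idn_at X n a) = f) \<and>
     (\<forall>a\<in>ob X. \<forall>b\<in>ob X. \<forall>c\<in>ob X. \<forall>d\<in>ob X. \<forall>n.
        \<forall>f\<in>simp (hom X a b) n. \<forall>g\<in>simp (hom X b c) n. \<forall>h\<in>simp (hom X c d) n.
          cmp X a c d n h (cmp X a b c n g f) = cmp X a b d n (cmp X b c d n h g) f)"

type_synonym ('o, 'h, 'p, 'k) sfun = "('o \<Rightarrow> 'p) \<times> ('o \<Rightarrow> 'o \<Rightarrow> nat \<Rightarrow> 'h \<Rightarrow> 'k)"

definition is_sfun :: "('o, 'h) scat \<Rightarrow> ('p, 'k) scat \<Rightarrow> ('o, 'h, 'p, 'k) sfun \<Rightarrow> bool" where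
  "is_sfun X Y = (\<lambda>(F, \<Phi>).
     F \<in> ob X \<rightarrow>\<^sub>E ob Y \<and>
     (\<forall>a\<in>ob X. \<forall>b\<in>ob X. is_sset_map (hom X a b) (hom Y (F a) (F b)) (\<Phi> a b)) \<and>
     (\<forall>a b. \<not> (a \<in> ob X \<and> b \<in> ob X) \<longrightarrow> \<Phi> a b = undefined) \<and>
     (\<forall>a\<in>ob X. \<Phi> a a 0 (idn X a) = idn Y (F a)) \<and>
     (\<forall>a\<in>ob X. \<forall>b\<in>ob X. \<forall>c\<in>ob X. \<forall>n. \<forall>g\<in>simp (hom X b c) n. \<forall>f\<in>simp (hom X a b) n.
        \<Phi> a c n (cmp X a b c n g f) = cmp Y (F a) (F b) (F c) n (\<Phi> b c n g) (\<Phi> a b n f)))"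

definition id_sfun :: "('o, 'h) scat \<Rightarrow> ('o, 'h, 'o, 'h) sfun" where
  "id_sfun X = (\<lambda>a\<in>ob X. a,
     \<lambda>a b. if a \<in> ob X \<and> b \<in> ob X then (\<lambda>n. \<lambda>f\<in>simp (hom X a b) n. f) else undefined)"

text \<open>The first argument of \<open>comp_sfun\<close> is the source of the composite.\<close>

definition comp_sfun ::
  "('o, 'h) scat \<Rightarrow> ('p, 'k, 'q, 'l) sfun \<Rightarrow> ('o, 'h, 'p, 'k) sfun \<Rightarrow> ('o, 'h, 'q, 'l) sfun" where
  "comp_sfun X = (\<lambda>(G, \<Gamma>) (F, \<Phi>).
     (compose (ob X) G F,
      \<lambda>a b. if a \<in> ob X \<and> b \<in> ob X
            then (\<lambda>n. compose (simp (hom X a b) n) (\<Gamma> (F a) (F b) n) (\<Phi> a b n))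
            else undefined))"

type_synonym ('o, 'h) scat_arr = "('o, 'h) scat \<times> ('o, 'h) scat \<times> ('o, 'h, 'o, 'h) sfun"

definition sCat :: "(('o, 'h) scat, ('o, 'h) scat_arr) cat" where
  "sCat = \<lparr>Obj = {X. is_scat X},
           Hom = (\<lambda>X Y. {(X, Y, F) | F. is_sfun X Y F}),
           Id = (\<lambda>X. (X, X, id_sfun X)),
           Comp = (\<lambda>(_, Z, G) (X, _, F). (X, Z, comp_sfun X G F))\<rparr>"

definition op_scat :: "('o, 'h) scat \<Rightarrow> ('o, 'h) scat" where
  "op_scat X = \<lparr>ob = ob X, hom = (\<lambda>a b. hom X b a), idn = idn X,
                cmp = (\<lambda>a b c n g f. cmp X c b a n f g)\<rparr>"

definition op_sCat :: "(('o, 'h) scat, ('o, 'h) scat_arr, ('o, 'h) scat, ('o, 'h) scat_arr) ftr" where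
  "op_sCat = \<lparr>on_obj = op_scat,
              on_arr = (\<lambda>(X, Y, (F, \<Phi>)). (op_scat X, op_scat Y, (F, \<lambda>a b. \<Phi> b a)))\<rparr>"


section \<open>The homotopy coherent nerve\<close>

definition poset_nerve :: "'v set set \<Rightarrow> (nat \<Rightarrow> 'v set) sset" where
  "poset_nerve P = \<lparr>simp = (\<lambda>k. {T \<in> {..k} \<rightarrow>\<^sub>E P. mono_on {..k} T}),
     act = (\<lambda>l k \<theta>. if \<theta> \<in> Delta l k
                    then (\<lambda>T\<in>{T \<in> {..k} \<rightarrow>\<^sub>E P. mono_on {..k} T}. compose {..l} T \<theta>)
                    else undefined)\<rparr>"

text \<open>
  \<open>coherent n\<close> is the simplicial category \<open>\<CC>(\<Delta>\<^sup>n)\<close>. For \<open>j < i\<close> the poset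
  \<open>{S. S \<subseteq> {i..j} \<and> i \<in> S \<and> j \<in> S}\<close> is empty, and so is its nerve. Composition is union of subsets.
  The nerve \<open>Nhc\<close> below is \<open>X \<mapsto> sCat(\<CC>(\<Delta>\<^sup>n), X)\<close>, so by the Yoneda lemma every left adjoint of \<open>Nhc\<close>
  takes \<open>\<Delta>\<^sup>n\<close> to \<open>coherent n\<close>, up to an isomorphism natural in \<open>n\<close>; this is how \<open>\<CC>\<close> is pinned down.
\<close>

definition coherent :: "nat \<Rightarrow> (nat, nat \<Rightarrow> nat set) scat" where
  "coherent n = \<lparr>ob = {..n},
     hom = (\<lambda>i j. poset_nerve {S. S \<subseteq> {i..j} \<and> i \<in> S \<and> j \<in> S}),
     idn = (\<lambda>i. \<lambda>r\<in>{..0}. {i}),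
     cmp = (\<lambda>i j l k T S. \<lambda>r\<in>{..k}. T r \<union> S r)\<rparr>"

definition coherent_map ::
  "nat \<Rightarrow> nat \<Rightarrow> (nat \<Rightarrow> nat) \<Rightarrow> (nat, nat \<Rightarrow> nat set, nat, nat \<Rightarrow> nat set) sfun" where
  "coherent_map m n \<theta> = (\<theta>,
     \<lambda>i j. if i \<in> {..m} \<and> j \<in> {..m}
           then (\<lambda>k. \<lambda>T\<in>simp (hom (coherent m) i j) k. \<lambda>r\<in>{..k}. \<theta> ` T r)
           else undefined)"

text \<open>
  The universe in which all small objects live. An \<open>n\<close>-simplex of \<open>N\<^sub>h\<^sub>c X\<close> is a simplicial functor
  \<open>\<CC>(\<Delta>\<^sup>n) \<rightarrow> X\<close>; the constructor \<open>Simplex\<close> makes such a functor an element of the type its values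
  are taken from, so that \<open>N\<^sub>h\<^sub>c\<close> maps small simplicial categories to small simplicial sets. As
  \<open>'a\<close> is arbitrary, no bound is put on the size of small objects: \<open>Atom\<close> embeds any given type.
  Via \<open>Simplex\<close> the type contains (encodings of) all its countable sequences. It is therefore also
  closed under \<open>\<CC>\<close>: the vertices of \<open>A\<close> are the objects of \<open>\<CC>(A)\<close>, and each simplex of a mapping space
  is represented by a finite sequence of simplices of \<open>A\<close> together with finite combinatorial data.
\<close>

datatype 'a univ =
    Atom 'a
  | Simplex "(nat, nat \<Rightarrow> nat set, 'a univ, 'a univ) sfun"

primrec the_Simplex :: "'a univ \<Rightarrow> (nat, nat \<Rightarrow> nat set, 'a univ, 'a univ) sfun" where
  "the_Simplex (Simplex F) = F"
| "the_Simplex (Atom a) = undefined"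

type_synonym 'a usset = "'a univ sset"
type_synonym 'a usset_arr = "'a univ sset_arr"
type_synonym 'a uscat = "('a univ, 'a univ) scat"
type_synonym 'a uscat_arr = "('a univ, 'a univ) scat_arr"

definition Nhc_obj :: "'a uscat \<Rightarrow> 'a usset" where
  "Nhc_obj X = \<lparr>simp = (\<lambda>n. Simplex ` {F. is_sfun (coherent n) X F}),
     act = (\<lambda>m n \<theta>. if \<theta> \<in> Delta m n
        then (\<lambda>x\<in>Simplex ` {F. is_sfun (coherent n) X F}.
                Simplex (comp_sfun (coherent m) (the_Simplex x) (coherent_map m n \<theta>)))
        else undefined)\<rparr>"

definition Nhc :: "('a uscat, 'a uscat_arr, 'a usset, 'a usset_arr) ftr" where
  "Nhc = \<lparr>on_obj = Nhc_obj,
     on_arr = (\<lambda>(X, Y, G). (Nhc_obj X, Nhc_obj Y,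
        \<lambda>n. \<lambda>x\<in>simp (Nhc_obj X) n. Simplex (comp_sfun (coherent n) G (the_Simplex x))))\<rparr>"


section \<open>Objects with anti-involution\<close>

text \<open>\<open>P\<close> is the functor \<open>(-)\<^sup>o\<^sup>p : C \<rightarrow> C\<close>, which satisfies \<open>P P = id\<close>.\<close>

definition involutive :: "('o, 'm) cat \<Rightarrow> ('o, 'm, 'o, 'm) ftr \<Rightarrow> ('o \<times> 'm, 'm) cat" where
  "involutive C P = \<lparr>
     Obj = {(X, \<tau>). X \<in> Obj C \<and> \<tau> \<in> Hom C (on_obj P X) X \<and>
              Comp C (on_arr P \<tau>) \<tau> = Id C (on_obj P X)},
     Hom = (\<lambda>(X, \<tau>) (X', \<tau>'). {f \<in> Hom C X X'. Comp C \<tau>' (on_arr P f) = Comp C f \<tau>}),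
     Id = (\<lambda>(X, \<tau>). Id C X),
     Comp = Comp C\<rparr>"

definition isSet :: "('a usset \<times> 'a usset_arr, 'a usset_arr) cat" where
  "isSet = involutive sSet op_sSet"

definition isCat :: "('a uscat \<times> 'a uscat_arr, 'a uscat_arr) cat" where
  "isCat = involutive sCat op_sCat"

text \<open>The functor \<open>(X, \<tau>) \<mapsto> (F X, F \<tau> \<circ> u\<^sub>X)\<close> for \<open>F : C \<rightarrow> D\<close> and \<open>u\<^sub>X : (F X)\<^sup>o\<^sup>p \<rightarrow> F (X\<^sup>o\<^sup>p)\<close>.\<close>

definition involutive_lift ::
  "('p, 'n) cat \<Rightarrow> ('o, 'm, 'p, 'n) ftr \<Rightarrow> ('o \<Rightarrow> 'n) \<Rightarrow> ('o \<times> 'm, 'm, 'p \<times> 'n, 'n) ftr" where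
  "involutive_lift D F u =
     \<lparr>on_obj = (\<lambda>(X, \<tau>). (on_obj F X, Comp D (on_arr F \<tau>) (u X))), on_arr = on_arr F\<rparr>"

end

theory Submission
  imports Defs
begin

text \<open>
  The theorem is an instance of a lifting principle for adjunctions, applied to the functors \<open>(-)\<^sup>o\<^sup>p\<close>
  on simplicial sets and on simplicial categories (\<open>functor_op_sSet\<close>, \<open>functor_op_sCat\<close>). Let \<open>F \<stileturn> G\<close> be an adjunction
  between categories with involutions \<open>P\<close> and \<open>Q\<close>, with comparison maps \<open>z\<^sub>Y : P G Y \<rightarrow> G Q Y\<close> and
  \<open>w\<^sub>A : Q F A \<rightarrow> F P A\<close>. The condition
  \<open>w\<^sub>A\<^sup>-\<^sup>1 = \<epsilon> \<circ> F z \<circ> F P \<eta>\<close> says that \<open>w\<close> and \<open>z\<close> are mates (up to inversion), and it is exactly what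
  makes the unit and the counit compatible with the anti-involutions:

  \<^item> \<open>G w\<^sub>A \<circ> z\<^sub>F\<^sub>A \<circ> P \<eta>\<^sub>A = \<eta>\<^sub>P\<^sub>A\<close>, because \<open>z\<^sub>F\<^sub>A \<circ> P \<eta>\<^sub>A\<close> is the adjunct of \<open>w\<^sub>A\<^sup>-\<^sup>1\<close>
    (\<open>unit_compatible\<close>);
  \<^item> \<open>\<epsilon>\<^sub>Q\<^sub>Y \<circ> F z\<^sub>Y \<circ> w\<^sub>G\<^sub>Y = Q \<epsilon>\<^sub>Y\<close>, by naturality of \<open>\<epsilon>\<close> and \<open>z\<close> and a triangle identity
    (\<open>counit_compatible\<close>).

  Hence each component of \<open>\<eta>\<close> and \<open>\<epsilon>\<close> is a morphism of objects with anti-involution. Since the lifted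
  categories have the same composition and identities as the original ones, naturality and the
  triangle identities are inherited (\<open>adjunction_lift\<close>).
\<close>

section \<open>Arrows, functors and natural transformations\<close>

lemma id_in_Hom: "category C \<Longrightarrow> X \<in> Obj C \<Longrightarrow> Id C X \<in> Hom C X X"
  by (simp add: category_def)

lemma comp_in_Hom:
  "category C \<Longrightarrow> f \<in> Hom C X Y \<Longrightarrow> g \<in> Hom C Y Z \<Longrightarrow> X \<in> Obj C \<Longrightarrow> Y \<in> Obj C \<Longrightarrow> Z \<in> Obj C
     \<Longrightarrow> Comp C g f \<in> Hom C X Z"
  unfolding category_def by blast

lemma comp_id_left:
  "category C \<Longrightarrow> f \<in> Hom C X Y \<Longrightarrow> X \<in> Obj C \<Longrightarrow> Y \<in> Obj C \<Longrightarrow> Comp C (Id C Y) f = f"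
  unfolding category_def by blast

lemma comp_id_right:
  "category C \<Longrightarrow> f \<in> Hom C X Y \<Longrightarrow> X \<in> Obj C \<Longrightarrow> Y \<in> Obj C \<Longrightarrow> Comp C f (Id C X) = f"
  unfolding category_def by blast

lemma comp_assoc:
  "category C \<Longrightarrow> f \<in> Hom C W X \<Longrightarrow> g \<in> Hom C X Y \<Longrightarrow> h \<in> Hom C Y Z
     \<Longrightarrow> W \<in> Obj C \<Longrightarrow> X \<in> Obj C \<Longrightarrow> Y \<in> Obj C \<Longrightarrow> Z \<in> Obj C
     \<Longrightarrow> Comp C h (Comp C g f) = Comp C (Comp C h g) f"
  unfolding category_def by blast

lemma functor_categories:
  "is_functor C D F \<Longrightarrow> category C" "is_functor C D F \<Longrightarrow> category D"
  by (simp_all add: is_functor_def)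

lemma functor_obj: "is_functor C D F \<Longrightarrow> X \<in> Obj C \<Longrightarrow> on_obj F X \<in> Obj D"
  by (simp add: is_functor_def)

lemma functor_arr:
  "is_functor C D F \<Longrightarrow> f \<in> Hom C X Y \<Longrightarrow> X \<in> Obj C \<Longrightarrow> Y \<in> Obj C
     \<Longrightarrow> on_arr F f \<in> Hom D (on_obj F X) (on_obj F Y)"
  unfolding is_functor_def by blast

lemma functor_id: "is_functor C D F \<Longrightarrow> X \<in> Obj C \<Longrightarrow> on_arr F (Id C X) = Id D (on_obj F X)"
  by (simp add: is_functor_def)

lemma functor_comp:
  "is_functor C D F \<Longrightarrow> f \<in> Hom C X Y \<Longrightarrow> g \<in> Hom C Y Z \<Longrightarrow> X \<in> Obj C \<Longrightarrow> Y \<in> Obj C \<Longrightarrow> Z \<in> Obj C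
     \<Longrightarrow> on_arr F (Comp C g f) = Comp D (on_arr F g) (on_arr F f)"
  unfolding is_functor_def by blast

lemma nat_in_Hom:
  "natural_transformation C D F G \<alpha> \<Longrightarrow> X \<in> Obj C \<Longrightarrow> \<alpha> X \<in> Hom D (on_obj F X) (on_obj G X)"
  by (simp add: natural_transformation_def)

lemma naturality:
  "natural_transformation C D F G \<alpha> \<Longrightarrow> f \<in> Hom C X Y \<Longrightarrow> X \<in> Obj C \<Longrightarrow> Y \<in> Obj C
     \<Longrightarrow> Comp D (\<alpha> Y) (on_arr F f) = Comp D (on_arr G f) (\<alpha> X)"
  unfolding natural_transformation_def by blast

lemma functor_id_ftr: "category C \<Longrightarrow> is_functor C C id_ftr"
  by (simp add: is_functor_def id_ftr_def category_def)

lemma functor_comp_ftr: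
  assumes "is_functor C D F" "is_functor D E G" shows "is_functor C E (G \<circ>\<^sub>F F)"
  using assms unfolding is_functor_def comp_ftr_def by simp blast


section \<open>Lifting functors to objects with anti-involution\<close>

lemma involutive_simps:
  "(X, \<tau>) \<in> Obj (involutive C P) \<longleftrightarrow>
     X \<in> Obj C \<and> \<tau> \<in> Hom C (on_obj P X) X \<and> Comp C (on_arr P \<tau>) \<tau> = Id C (on_obj P X)"
  "f \<in> Hom (involutive C P) (X, \<tau>) (Y, \<upsilon>) \<longleftrightarrow>
     f \<in> Hom C X Y \<and> Comp C \<upsilon> (on_arr P f) = Comp C f \<tau>"
  "Id (involutive C P) (X, \<tau>) = Id C X"
  "Comp (involutive C P) = Comp C"
  by (simp_all add: involutive_def)

lemma category_involutive:
  assumes P: "is_functor C C P"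
  shows "category (involutive C P)"
proof -
  note C = functor_categories(1)[OF P]
  have comp: "Comp C g f \<in> Hom (involutive C P) (X, \<tau>) (Z, \<rho>)"
    if X: "(X, \<tau>) \<in> Obj (involutive C P)" and Y: "(Y, \<upsilon>) \<in> Obj (involutive C P)"
      and Z: "(Z, \<rho>) \<in> Obj (involutive C P)"
      and f: "f \<in> Hom (involutive C P) (X, \<tau>) (Y, \<upsilon>)"
      and g: "g \<in> Hom (involutive C P) (Y, \<upsilon>) (Z, \<rho>)" for X \<tau> Y \<upsilon> Z \<rho> f g
  proof -
    note [simp] = X[unfolded involutive_simps] Y[unfolded involutive_simps]
      Z[unfolded involutive_simps] f[unfolded involutive_simps] g[unfolded involutive_simps]
      functor_obj[OF P]
    have Pf: "on_arr P f \<in> Hom C (on_obj P X) (on_obj P Y)" by (simp add: functor_arr[OF P])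
    have Pg: "on_arr P g \<in> Hom C (on_obj P Y) (on_obj P Z)" by (simp add: functor_arr[OF P])
    have "Comp C \<rho> (on_arr P (Comp C g f)) = Comp C \<rho> (Comp C (on_arr P g) (on_arr P f))"
      by (subst functor_comp[OF P, of f X Y g Z]) simp_all
    also have "\<dots> = Comp C (Comp C \<rho> (on_arr P g)) (on_arr P f)"
      by (rule comp_assoc[OF C Pf Pg, of _ Z]) simp_all
    also have "\<dots> = Comp C (Comp C g \<upsilon>) (on_arr P f)" by simp
    also have "\<dots> = Comp C g (Comp C \<upsilon> (on_arr P f))"
      by (rule comp_assoc[OF C Pf, of _ Y _ Z, symmetric]) simp_all
    also have "\<dots> = Comp C g (Comp C f \<tau>)" by simp
    also have "\<dots> = Comp C (Comp C g f) \<tau>"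
      by (rule comp_assoc[OF C, of _ "on_obj P X" X _ Y _ Z]) simp_all
    finally show ?thesis
      by (simp add: involutive_simps comp_in_Hom[OF C, of f X Y g Z])
  qed
  have id: "Id C X \<in> Hom (involutive C P) (X, \<tau>) (X, \<tau>)"
    if "(X, \<tau>) \<in> Obj (involutive C P)" for X \<tau>
    using that functor_obj[OF P, of X]
    by (auto simp: involutive_simps id_in_Hom[OF C] functor_id[OF P]
        comp_id_left[OF C] comp_id_right[OF C])
  show ?thesis
    unfolding category_def
  proof (intro conjI ballI; clarify)
    fix X \<tau> assume "(X, \<tau>) \<in> Obj (involutive C P)"
    then show "Id (involutive C P) (X, \<tau>) \<in> Hom (involutive C P) (X, \<tau>) (X, \<tau>)"
      by (simp add: id involutive_simps(3))
  next
    fix X \<tau> Y \<upsilon> Z \<rho> f g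
    assume "(X, \<tau>) \<in> Obj (involutive C P)" "(Y, \<upsilon>) \<in> Obj (involutive C P)"
      "(Z, \<rho>) \<in> Obj (involutive C P)"
      "f \<in> Hom (involutive C P) (X, \<tau>) (Y, \<upsilon>)" "g \<in> Hom (involutive C P) (Y, \<upsilon>) (Z, \<rho>)"
    then show "Comp (involutive C P) g f \<in> Hom (involutive C P) (X, \<tau>) (Z, \<rho>)"
      unfolding involutive_simps(4) by (rule comp)
  next
    fix X \<tau> Y \<upsilon> f
    assume "(X, \<tau>) \<in> Obj (involutive C P)" "(Y, \<upsilon>) \<in> Obj (involutive C P)"
      "f \<in> Hom (involutive C P) (X, \<tau>) (Y, \<upsilon>)"
    then show "Comp (involutive C P) (Id (involutive C P) (Y, \<upsilon>)) f = f"
      by (simp add: involutive_simps comp_id_left[OF C, of f X Y])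
  next
    fix X \<tau> Y \<upsilon> f
    assume "(X, \<tau>) \<in> Obj (involutive C P)" "(Y, \<upsilon>) \<in> Obj (involutive C P)"
      "f \<in> Hom (involutive C P) (X, \<tau>) (Y, \<upsilon>)"
    then show "Comp (involutive C P) f (Id (involutive C P) (X, \<tau>)) = f"
      by (simp add: involutive_simps comp_id_right[OF C, of f X Y])
  next
    fix W \<omega> X \<tau> Y \<upsilon> Z \<rho> f g h
    assume "(W, \<omega>) \<in> Obj (involutive C P)" "(X, \<tau>) \<in> Obj (involutive C P)"
      "(Y, \<upsilon>) \<in> Obj (involutive C P)" "(Z, \<rho>) \<in> Obj (involutive C P)"
      "f \<in> Hom (involutive C P) (W, \<omega>) (X, \<tau>)" "g \<in> Hom (involutive C P) (X, \<tau>) (Y, \<upsilon>)"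
      "h \<in> Hom (involutive C P) (Y, \<upsilon>) (Z, \<rho>)"
    then show "Comp (involutive C P) h (Comp (involutive C P) g f)
        = Comp (involutive C P) (Comp (involutive C P) h g) f"
      by (simp add: involutive_simps comp_assoc[OF C, of f W X g Y h Z])
  qed
qed

text \<open>
  That \<open>F \<sigma> \<circ> u\<^sub>A\<close> is again an anti-involution uses that \<open>u\<close> is inverted by its own opposite: this
  identifies \<open>Q u\<^sub>A\<close> with the inverse of \<open>u\<^sub>P\<^sub>A\<close>, so that naturality of \<open>u\<close> at \<open>\<sigma>\<close> turns
  \<open>Q (F \<sigma> \<circ> u\<^sub>A) \<circ> F \<sigma> \<circ> u\<^sub>A\<close> into \<open>u\<^sub>A\<^sup>-\<^sup>1 \<circ> F (P \<sigma> \<circ> \<sigma>) \<circ> u\<^sub>A\<close>.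
\<close>

lemma functor_involutive_lift:
  assumes P: "is_functor C C P" and Q: "is_functor D D Q" and F: "is_functor C D F"
    and PP: "\<And>X. X \<in> Obj C \<Longrightarrow> on_obj P (on_obj P X) = X"
    and u: "natural_transformation C D (Q \<circ>\<^sub>F F) (F \<circ>\<^sub>F P) u"
    and inv: "\<And>X. X \<in> Obj C \<Longrightarrow> inverse_arrows D (on_obj Q (on_obj F X)) (on_obj F (on_obj P X))
                (u X) (on_arr Q (u (on_obj P X)))"
  shows "is_functor (involutive C P) (involutive D Q) (involutive_lift D F u)"
proof -
  note C = functor_categories(1)[OF P] and D = functor_categories(1)[OF Q]
  note [simp] = functor_obj[OF P] functor_obj[OF Q] functor_obj[OF F] PP
  have u_hom [simp]: "u X \<in> Hom D (on_obj Q (on_obj F X)) (on_obj F (on_obj P X))"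
    if "X \<in> Obj C" for X
    using inv[OF that] by (simp add: inverse_arrows_def)
  have u_nat: "Comp D (u Y) (on_arr Q (on_arr F f)) = Comp D (on_arr F (on_arr P f)) (u X)"
    if "f \<in> Hom C X Y" "X \<in> Obj C" "Y \<in> Obj C" for f X Y
    using naturality[OF u that] by (simp add: comp_ftr_def)
  have obj: "(on_obj F A, Comp D (on_arr F \<sigma>) (u A)) \<in> Obj (involutive D Q)"
    if "(A, \<sigma>) \<in> Obj (involutive C P)" for A \<sigma>
  proof -
    have A [simp]: "A \<in> Obj C" and \<sigma>: "\<sigma> \<in> Hom C (on_obj P A) A"
      and \<sigma>\<sigma>: "Comp C (on_arr P \<sigma>) \<sigma> = Id C (on_obj P A)"
      using that by (simp_all add: involutive_simps)
    let ?PA = "on_obj P A" and ?FA = "on_obj F A"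
    let ?FPA = "on_obj F ?PA"
    let ?v = "on_arr Q (u ?PA)" and ?v' = "on_arr Q (u A)"
    have P\<sigma>: "on_arr P \<sigma> \<in> Hom C A ?PA"
      using functor_arr[OF P \<sigma>] by simp
    have F\<sigma>: "on_arr F \<sigma> \<in> Hom D ?FPA ?FA" by (rule functor_arr[OF F \<sigma>]) simp_all
    have FP\<sigma>: "on_arr F (on_arr P \<sigma>) \<in> Hom D ?FA ?FPA" by (rule functor_arr[OF F P\<sigma>]) simp_all
    have QF\<sigma>: "on_arr Q (on_arr F \<sigma>) \<in> Hom D (on_obj Q ?FPA) (on_obj Q ?FA)"
      by (rule functor_arr[OF Q F\<sigma>]) simp_all
    have uA: "u A \<in> Hom D (on_obj Q ?FA) ?FPA" by simp
    have uPA: "u ?PA \<in> Hom D (on_obj Q ?FPA) ?FA" using u_hom[of ?PA] by simp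
    have v: "?v \<in> Hom D ?FPA (on_obj Q ?FA)" and vu: "Comp D ?v (u A) = Id D (on_obj Q ?FA)"
      using inv[of A] by (simp_all add: inverse_arrows_def)
    have v': "?v' \<in> Hom D ?FA (on_obj Q ?FPA)" and uv': "Comp D (u ?PA) ?v' = Id D ?FA"
      using inv[of ?PA] by (simp_all add: inverse_arrows_def)
    have F\<sigma>u: "Comp D (on_arr F \<sigma>) (u A) \<in> Hom D (on_obj Q ?FA) ?FA"
      by (rule comp_in_Hom[OF D uA F\<sigma>]) simp_all
    have QF\<sigma>v': "Comp D (on_arr Q (on_arr F \<sigma>)) ?v' \<in> Hom D ?FA (on_obj Q ?FA)"
      by (rule comp_in_Hom[OF D v' QF\<sigma>]) simp_all
    \<comment> \<open>Conjugating the naturality square at \<open>\<sigma>\<close> by the inverses of \<open>u\<close>.\<close>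
    have nat_inv: "Comp D (on_arr Q (on_arr F \<sigma>)) ?v' = Comp D ?v (on_arr F (on_arr P \<sigma>))"
    proof -
      have "Comp D (u A) (Comp D (on_arr Q (on_arr F \<sigma>)) ?v')
          = Comp D (Comp D (u A) (on_arr Q (on_arr F \<sigma>))) ?v'"
        by (rule comp_assoc[OF D v' QF\<sigma> uA]) simp_all
      also have "\<dots> = Comp D (Comp D (on_arr F (on_arr P \<sigma>)) (u ?PA)) ?v'"
        using u_nat[OF \<sigma>] by simp
      also have "\<dots> = Comp D (on_arr F (on_arr P \<sigma>)) (Comp D (u ?PA) ?v')"
        by (rule comp_assoc[OF D v' uPA FP\<sigma>, symmetric]) simp_all
      also have "\<dots> = on_arr F (on_arr P \<sigma>)"
        unfolding uv' by (rule comp_id_right[OF D FP\<sigma>]) simp_all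
      finally have eq: "Comp D (u A) (Comp D (on_arr Q (on_arr F \<sigma>)) ?v') = on_arr F (on_arr P \<sigma>)" .
      have "Comp D (on_arr Q (on_arr F \<sigma>)) ?v'
          = Comp D (Comp D ?v (u A)) (Comp D (on_arr Q (on_arr F \<sigma>)) ?v')"
        unfolding vu by (rule comp_id_left[OF D QF\<sigma>v', symmetric]) simp_all
      also have "\<dots> = Comp D ?v (Comp D (u A) (Comp D (on_arr Q (on_arr F \<sigma>)) ?v'))"
        by (rule comp_assoc[OF D QF\<sigma>v' uA v, symmetric]) simp_all
      finally show ?thesis unfolding eq .
    qed
    have "Comp D (on_arr Q (Comp D (on_arr F \<sigma>) (u A))) (Comp D (on_arr F \<sigma>) (u A))
        = Comp D (Comp D ?v (on_arr F (on_arr P \<sigma>))) (Comp D (on_arr F \<sigma>) (u A))"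
      using functor_comp[OF Q uA F\<sigma>] nat_inv by simp
    also have "\<dots> = Comp D ?v (Comp D (on_arr F (on_arr P \<sigma>)) (Comp D (on_arr F \<sigma>) (u A)))"
      by (rule comp_assoc[OF D F\<sigma>u FP\<sigma> v, symmetric]) simp_all
    also have "Comp D (on_arr F (on_arr P \<sigma>)) (Comp D (on_arr F \<sigma>) (u A))
        = Comp D (Comp D (on_arr F (on_arr P \<sigma>)) (on_arr F \<sigma>)) (u A)"
      by (rule comp_assoc[OF D uA F\<sigma> FP\<sigma>]) simp_all
    also have "Comp D (on_arr F (on_arr P \<sigma>)) (on_arr F \<sigma>) = Id D ?FPA"
      using functor_comp[OF F \<sigma> P\<sigma>] \<sigma>\<sigma> by (simp add: functor_id[OF F])
    also have "Comp D (Id D ?FPA) (u A) = u A"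
      by (rule comp_id_left[OF D uA]) simp_all
    also note vu
    finally show ?thesis
      using F\<sigma>u by (simp add: involutive_simps)
  qed
  have arr: "on_arr F f \<in> Hom (involutive D Q) (on_obj F A, Comp D (on_arr F \<sigma>) (u A))
                            (on_obj F B, Comp D (on_arr F \<rho>) (u B))"
    if A: "(A, \<sigma>) \<in> Obj (involutive C P)" and B: "(B, \<rho>) \<in> Obj (involutive C P)"
      and f: "f \<in> Hom (involutive C P) (A, \<sigma>) (B, \<rho>)" for A \<sigma> B \<rho> f
  proof -
    have [simp]: "A \<in> Obj C" "B \<in> Obj C"
      and \<sigma>: "\<sigma> \<in> Hom C (on_obj P A) A" and \<rho>: "\<rho> \<in> Hom C (on_obj P B) B"
      and f: "f \<in> Hom C A B" and f_eq: "Comp C \<rho> (on_arr P f) = Comp C f \<sigma>"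
      using A B f by (simp_all add: involutive_simps)
    have Pf: "on_arr P f \<in> Hom C (on_obj P A) (on_obj P B)" by (rule functor_arr[OF P f]) simp_all
    have Ff: "on_arr F f \<in> Hom D (on_obj F A) (on_obj F B)" by (rule functor_arr[OF F f]) simp_all
    have QFf: "on_arr Q (on_arr F f) \<in> Hom D (on_obj Q (on_obj F A)) (on_obj Q (on_obj F B))"
      by (rule functor_arr[OF Q Ff]) simp_all
    have FPf: "on_arr F (on_arr P f) \<in> Hom D (on_obj F (on_obj P A)) (on_obj F (on_obj P B))"
      by (rule functor_arr[OF F Pf]) simp_all
    have F\<sigma>: "on_arr F \<sigma> \<in> Hom D (on_obj F (on_obj P A)) (on_obj F A)"
      by (rule functor_arr[OF F \<sigma>]) simp_all
    have F\<rho>: "on_arr F \<rho> \<in> Hom D (on_obj F (on_obj P B)) (on_obj F B)"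
      by (rule functor_arr[OF F \<rho>]) simp_all
    have "Comp D (Comp D (on_arr F \<rho>) (u B)) (on_arr Q (on_arr F f))
        = Comp D (on_arr F \<rho>) (Comp D (u B) (on_arr Q (on_arr F f)))"
      by (rule comp_assoc[OF D QFf u_hom F\<rho>, symmetric]) simp_all
    also have "\<dots> = Comp D (on_arr F \<rho>) (Comp D (on_arr F (on_arr P f)) (u A))"
      using u_nat[OF f] by simp
    also have "\<dots> = Comp D (Comp D (on_arr F \<rho>) (on_arr F (on_arr P f))) (u A)"
      by (rule comp_assoc[OF D u_hom FPf F\<rho>]) simp_all
    also have "Comp D (on_arr F \<rho>) (on_arr F (on_arr P f)) = Comp D (on_arr F f) (on_arr F \<sigma>)"
      using functor_comp[OF F Pf \<rho>] functor_comp[OF F \<sigma> f] f_eq by simp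
    also have "Comp D (Comp D (on_arr F f) (on_arr F \<sigma>)) (u A)
        = Comp D (on_arr F f) (Comp D (on_arr F \<sigma>) (u A))"
      by (rule comp_assoc[OF D u_hom F\<sigma> Ff, symmetric]) simp_all
    finally show ?thesis
      using Ff by (simp add: involutive_simps)
  qed
  show ?thesis
    unfolding is_functor_def
  proof (intro conjI ballI category_involutive P Q; clarify)
    fix A \<sigma> assume "(A, \<sigma>) \<in> Obj (involutive C P)"
    then show "on_obj (involutive_lift D F u) (A, \<sigma>) \<in> Obj (involutive D Q)"
      by (simp add: involutive_lift_def obj)
  next
    fix A \<sigma> B \<rho> f
    assume "(A, \<sigma>) \<in> Obj (involutive C P)" "(B, \<rho>) \<in> Obj (involutive C P)"
      "f \<in> Hom (involutive C P) (A, \<sigma>) (B, \<rho>)"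
    then show "on_arr (involutive_lift D F u) f \<in> Hom (involutive D Q)
        (on_obj (involutive_lift D F u) (A, \<sigma>)) (on_obj (involutive_lift D F u) (B, \<rho>))"
      by (simp add: involutive_lift_def arr)
  next
    fix A \<sigma> assume "(A, \<sigma>) \<in> Obj (involutive C P)"
    then show "on_arr (involutive_lift D F u) (Id (involutive C P) (A, \<sigma>))
        = Id (involutive D Q) (on_obj (involutive_lift D F u) (A, \<sigma>))"
      by (simp add: involutive_lift_def involutive_simps functor_id[OF F])
  next
    fix A \<sigma> B \<rho> E \<kappa> f g
    assume "(A, \<sigma>) \<in> Obj (involutive C P)" "(B, \<rho>) \<in> Obj (involutive C P)"
      "(E, \<kappa>) \<in> Obj (involutive C P)"
      "f \<in> Hom (involutive C P) (A, \<sigma>) (B, \<rho>)" "g \<in> Hom (involutive C P) (B, \<rho>) (E, \<kappa>)"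
    then show "on_arr (involutive_lift D F u) (Comp (involutive C P) g f)
        = Comp (involutive D Q) (on_arr (involutive_lift D F u) g) (on_arr (involutive_lift D F u) f)"
      by (simp add: involutive_lift_def involutive_simps functor_comp[OF F, of f A B g E])
  qed
qed


section \<open>Lifting adjunctions to objects with anti-involution\<close>

text \<open>
  The data of a comparison between an adjunction and a pair of involutions. The assumption \<open>mate\<close>
  makes \<open>w\<^sub>A\<^sup>-\<^sup>1 : F P A \<rightarrow> Q F A\<close> the adjunct of \<open>z\<^sub>F\<^sub>A \<circ> P \<eta>\<^sub>A : P A \<rightarrow> G Q F A\<close>.
\<close>

locale involutive_adjunction =
  fixes C :: "('o, 'm) cat" and D :: "('p, 'n) cat"
    and P :: "('o, 'm, 'o, 'm) ftr" and Q :: "('p, 'n, 'p, 'n) ftr"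
    and F :: "('o, 'm, 'p, 'n) ftr" and G :: "('p, 'n, 'o, 'm) ftr"
    and \<eta> :: "'o \<Rightarrow> 'm" and \<epsilon> :: "'p \<Rightarrow> 'n" and z :: "'p \<Rightarrow> 'm" and w :: "'o \<Rightarrow> 'n"
  assumes P: "is_functor C C P" and Q: "is_functor D D Q"
    and PP: "\<And>X. X \<in> Obj C \<Longrightarrow> on_obj P (on_obj P X) = X"
    and QQ: "\<And>Y. Y \<in> Obj D \<Longrightarrow> on_obj Q (on_obj Q Y) = Y"
    and adj: "adjunction C D F G \<eta> \<epsilon>"
    and z: "natural_transformation D C (P \<circ>\<^sub>F G) (G \<circ>\<^sub>F Q) z"
    and w: "natural_transformation C D (Q \<circ>\<^sub>F F) (F \<circ>\<^sub>F P) w"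
    and z_inv: "\<And>Y. Y \<in> Obj D \<Longrightarrow> inverse_arrows C (on_obj P (on_obj G Y)) (on_obj G (on_obj Q Y))
                  (z Y) (on_arr P (z (on_obj Q Y)))"
    and w_inv: "\<And>X. X \<in> Obj C \<Longrightarrow> inverse_arrows D (on_obj Q (on_obj F X)) (on_obj F (on_obj P X))
                  (w X) (on_arr Q (w (on_obj P X)))"
    and mate: "\<And>X. X \<in> Obj C \<Longrightarrow> inverse_arrows D (on_obj Q (on_obj F X)) (on_obj F (on_obj P X))
                  (w X) (Comp D (\<epsilon> (on_obj Q (on_obj F X)))
                    (Comp D (on_arr F (z (on_obj F X))) (on_arr F (on_arr P (\<eta> X)))))"
begin

lemma F: "is_functor C D F" and G: "is_functor D C G"
  and \<eta>: "natural_transformation C C id_ftr (G \<circ>\<^sub>F F) \<eta>"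
  and \<epsilon>: "natural_transformation D D (F \<circ>\<^sub>F G) id_ftr \<epsilon>"
  using adj by (simp_all add: adjunction_def)

lemma C: "category C" and D: "category D"
  using functor_categories[OF F] .

lemma obj [simp]:
  "X \<in> Obj C \<Longrightarrow> on_obj P X \<in> Obj C" "Y \<in> Obj D \<Longrightarrow> on_obj Q Y \<in> Obj D"
  "X \<in> Obj C \<Longrightarrow> on_obj F X \<in> Obj D" "Y \<in> Obj D \<Longrightarrow> on_obj G Y \<in> Obj C"
  by (fact functor_obj[OF P] functor_obj[OF Q] functor_obj[OF F] functor_obj[OF G])+

lemma triangle_left: "X \<in> Obj C \<Longrightarrow> Comp D (\<epsilon> (on_obj F X)) (on_arr F (\<eta> X)) = Id D (on_obj F X)"
  and triangle_right: "Y \<in> Obj D \<Longrightarrow> Comp C (on_arr G (\<epsilon> Y)) (\<eta> (on_obj G Y)) = Id C (on_obj G Y)"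
  using adj by (simp_all add: adjunction_def)

lemma \<eta>_in_Hom: "X \<in> Obj C \<Longrightarrow> \<eta> X \<in> Hom C X (on_obj G (on_obj F X))"
  and \<epsilon>_in_Hom: "Y \<in> Obj D \<Longrightarrow> \<epsilon> Y \<in> Hom D (on_obj F (on_obj G Y)) Y"
  and z_in_Hom: "Y \<in> Obj D \<Longrightarrow> z Y \<in> Hom C (on_obj P (on_obj G Y)) (on_obj G (on_obj Q Y))"
  and w_in_Hom: "X \<in> Obj C \<Longrightarrow> w X \<in> Hom D (on_obj Q (on_obj F X)) (on_obj F (on_obj P X))"
  using nat_in_Hom[OF \<eta>] nat_in_Hom[OF \<epsilon>] nat_in_Hom[OF z] nat_in_Hom[OF w]
  by (simp_all add: id_ftr_def comp_ftr_def)

lemma \<eta>_nat: "f \<in> Hom C X X' \<Longrightarrow> X \<in> Obj C \<Longrightarrow> X' \<in> Obj C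
    \<Longrightarrow> Comp C (\<eta> X') f = Comp C (on_arr G (on_arr F f)) (\<eta> X)"
  and \<epsilon>_nat: "g \<in> Hom D V Y \<Longrightarrow> V \<in> Obj D \<Longrightarrow> Y \<in> Obj D
    \<Longrightarrow> Comp D (\<epsilon> Y) (on_arr F (on_arr G g)) = Comp D g (\<epsilon> V)"
  and z_nat: "g \<in> Hom D V Y \<Longrightarrow> V \<in> Obj D \<Longrightarrow> Y \<in> Obj D
    \<Longrightarrow> Comp C (z Y) (on_arr P (on_arr G g)) = Comp C (on_arr G (on_arr Q g)) (z V)"
  using naturality[OF \<eta>, of f X X'] naturality[OF \<epsilon>, of g V Y] naturality[OF z, of g V Y]
  by (simp_all add: id_ftr_def comp_ftr_def)

lemma adjunct_recovers:
  assumes X: "X \<in> Obj C" and Y: "Y \<in> Obj D" and k: "k \<in> Hom C X (on_obj G Y)"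
  shows "Comp C (on_arr G (Comp D (\<epsilon> Y) (on_arr F k))) (\<eta> X) = k"
proof -
  note [simp] = X Y
  have Fk: "on_arr F k \<in> Hom D (on_obj F X) (on_obj F (on_obj G Y))"
    by (rule functor_arr[OF F k]) simp_all
  have GFk: "on_arr G (on_arr F k) \<in> Hom C (on_obj G (on_obj F X)) (on_obj G (on_obj F (on_obj G Y)))"
    by (rule functor_arr[OF G Fk]) simp_all
  have G\<epsilon>: "on_arr G (\<epsilon> Y) \<in> Hom C (on_obj G (on_obj F (on_obj G Y))) (on_obj G Y)"
    by (rule functor_arr[OF G \<epsilon>_in_Hom]) simp_all
  have "Comp C (on_arr G (Comp D (\<epsilon> Y) (on_arr F k))) (\<eta> X)
      = Comp C (Comp C (on_arr G (\<epsilon> Y)) (on_arr G (on_arr F k))) (\<eta> X)"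
    using functor_comp[OF G Fk \<epsilon>_in_Hom] by simp
  also have "\<dots> = Comp C (on_arr G (\<epsilon> Y)) (Comp C (on_arr G (on_arr F k)) (\<eta> X))"
    by (rule comp_assoc[OF C \<eta>_in_Hom GFk G\<epsilon>, symmetric]) simp_all
  also have "\<dots> = Comp C (on_arr G (\<epsilon> Y)) (Comp C (\<eta> (on_obj G Y)) k)"
    using \<eta>_nat[OF k] by simp
  also have "\<dots> = Comp C (Comp C (on_arr G (\<epsilon> Y)) (\<eta> (on_obj G Y))) k"
    by (rule comp_assoc[OF C k \<eta>_in_Hom G\<epsilon>]) simp_all
  also have "\<dots> = k"
    unfolding triangle_right[OF Y] by (rule comp_id_left[OF C k]) simp_all
  finally show ?thesis .
qed

definition transposed_mate :: "'o \<Rightarrow> 'm" where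
  "transposed_mate X = Comp C (z (on_obj F X)) (on_arr P (\<eta> X))"

definition mate_inverse :: "'o \<Rightarrow> 'n" where
  "mate_inverse X = Comp D (\<epsilon> (on_obj Q (on_obj F X))) (on_arr F (transposed_mate X))"

lemma P\<eta>_in_Hom:
  "X \<in> Obj C \<Longrightarrow> on_arr P (\<eta> X) \<in> Hom C (on_obj P X) (on_obj P (on_obj G (on_obj F X)))"
  by (rule functor_arr[OF P \<eta>_in_Hom]) simp_all

lemma transposed_mate_in_Hom:
  "X \<in> Obj C \<Longrightarrow> transposed_mate X \<in> Hom C (on_obj P X) (on_obj G (on_obj Q (on_obj F X)))"
  unfolding transposed_mate_def by (rule comp_in_Hom[OF C P\<eta>_in_Hom z_in_Hom]) simp_all

lemma inverse_arrows_mate_inverse: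
  assumes X: "X \<in> Obj C"
  shows "inverse_arrows D (on_obj Q (on_obj F X)) (on_obj F (on_obj P X)) (w X) (mate_inverse X)"
  using mate[OF X] functor_comp[OF F P\<eta>_in_Hom[OF X] z_in_Hom] X
  by (simp add: mate_inverse_def transposed_mate_def)

text \<open>
  Transposing \<open>w\<^sub>A\<^sup>-\<^sup>1\<close> gives \<open>G w\<^sub>A\<^sup>-\<^sup>1 \<circ> \<eta>\<^sub>P\<^sub>A = z\<^sub>F\<^sub>A \<circ> P \<eta>\<^sub>A\<close>; applying \<open>G w\<^sub>A\<close> cancels the inverse.
\<close>

lemma unit_compatible:
  assumes X: "X \<in> Obj C"
  shows "Comp C (on_arr G (w X)) (transposed_mate X) = \<eta> (on_obj P X)"
proof -
  note [simp] = X
  let ?v = "mate_inverse X"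
  have v: "?v \<in> Hom D (on_obj F (on_obj P X)) (on_obj Q (on_obj F X))"
    and wv: "Comp D (w X) ?v = Id D (on_obj F (on_obj P X))"
    using inverse_arrows_mate_inverse[OF X] by (simp_all add: inverse_arrows_def)
  have Gv: "on_arr G ?v \<in> Hom C (on_obj G (on_obj F (on_obj P X))) (on_obj G (on_obj Q (on_obj F X)))"
    by (rule functor_arr[OF G v]) simp_all
  have Gw: "on_arr G (w X)
      \<in> Hom C (on_obj G (on_obj Q (on_obj F X))) (on_obj G (on_obj F (on_obj P X)))"
    by (rule functor_arr[OF G w_in_Hom]) simp_all
  have "transposed_mate X = Comp C (on_arr G ?v) (\<eta> (on_obj P X))"
    unfolding mate_inverse_def
    by (rule adjunct_recovers[OF _ _ transposed_mate_in_Hom, symmetric]) simp_all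
  then have "Comp C (on_arr G (w X)) (transposed_mate X)
      = Comp C (on_arr G (w X)) (Comp C (on_arr G ?v) (\<eta> (on_obj P X)))"
    by simp
  also have "\<dots> = Comp C (Comp C (on_arr G (w X)) (on_arr G ?v)) (\<eta> (on_obj P X))"
    by (rule comp_assoc[OF C \<eta>_in_Hom Gv Gw]) simp_all
  also have "Comp C (on_arr G (w X)) (on_arr G ?v) = Id C (on_obj G (on_obj F (on_obj P X)))"
    using functor_comp[OF G v w_in_Hom[OF X]] wv by (simp add: functor_id[OF G])
  also have "Comp C \<dots> (\<eta> (on_obj P X)) = \<eta> (on_obj P X)"
    by (rule comp_id_left[OF C \<eta>_in_Hom]) simp_all
  finally show ?thesis .
qed

text \<open>
  It suffices to compare both sides after precomposing with the invertible \<open>w\<^sub>G\<^sub>Y\<^sup>-\<^sup>1\<close>, and there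
  \<open>Q \<epsilon>\<^sub>Y \<circ> \<epsilon> \<circ> F (z \<circ> P \<eta>\<^sub>G\<^sub>Y) = \<epsilon>\<^sub>Q\<^sub>Y \<circ> F (G Q \<epsilon>\<^sub>Y \<circ> z \<circ> P \<eta>\<^sub>G\<^sub>Y) = \<epsilon>\<^sub>Q\<^sub>Y \<circ> F (z\<^sub>Y \<circ> P (G \<epsilon>\<^sub>Y \<circ> \<eta>\<^sub>G\<^sub>Y))\<close>,
  where the last factor is an identity.
\<close>

lemma counit_compatible:
  assumes Y: "Y \<in> Obj D"
  shows "Comp D (Comp D (\<epsilon> (on_obj Q Y)) (on_arr F (z Y))) (w (on_obj G Y)) = on_arr Q (\<epsilon> Y)"
proof -
  note [simp] = Y
  let ?GY = "on_obj G Y" and ?QY = "on_obj Q Y"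
  let ?FGY = "on_obj F ?GY"
  let ?k = "transposed_mate ?GY" and ?v = "mate_inverse ?GY"
  have v: "?v \<in> Hom D (on_obj F (on_obj P ?GY)) (on_obj Q ?FGY)"
    and vw: "Comp D ?v (w ?GY) = Id D (on_obj Q ?FGY)"
    using inverse_arrows_mate_inverse[of ?GY] by (simp_all add: inverse_arrows_def)
  have k: "?k \<in> Hom C (on_obj P ?GY) (on_obj G (on_obj Q ?FGY))"
    by (rule transposed_mate_in_Hom) simp
  have Q\<epsilon>: "on_arr Q (\<epsilon> Y) \<in> Hom D (on_obj Q ?FGY) ?QY"
    by (rule functor_arr[OF Q \<epsilon>_in_Hom]) simp_all
  have GQ\<epsilon>: "on_arr G (on_arr Q (\<epsilon> Y)) \<in> Hom C (on_obj G (on_obj Q ?FGY)) (on_obj G ?QY)"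
    by (rule functor_arr[OF G Q\<epsilon>]) simp_all
  have FGQ\<epsilon>: "on_arr F (on_arr G (on_arr Q (\<epsilon> Y)))
      \<in> Hom D (on_obj F (on_obj G (on_obj Q ?FGY))) (on_obj F (on_obj G ?QY))"
    by (rule functor_arr[OF F GQ\<epsilon>]) simp_all
  have Fk: "on_arr F ?k \<in> Hom D (on_obj F (on_obj P ?GY)) (on_obj F (on_obj G (on_obj Q ?FGY)))"
    by (rule functor_arr[OF F k]) simp_all
  have G\<epsilon>: "on_arr G (\<epsilon> Y) \<in> Hom C (on_obj G ?FGY) ?GY"
    by (rule functor_arr[OF G \<epsilon>_in_Hom]) simp_all
  have PG\<epsilon>: "on_arr P (on_arr G (\<epsilon> Y)) \<in> Hom C (on_obj P (on_obj G ?FGY)) (on_obj P ?GY)"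
    by (rule functor_arr[OF P G\<epsilon>]) simp_all
  have P\<eta>: "on_arr P (\<eta> ?GY) \<in> Hom C (on_obj P ?GY) (on_obj P (on_obj G ?FGY))"
    by (rule P\<eta>_in_Hom) simp
  have GQ\<epsilon>_k: "Comp C (on_arr G (on_arr Q (\<epsilon> Y))) ?k = z Y"
  proof -
    have "Comp C (on_arr G (on_arr Q (\<epsilon> Y))) ?k
        = Comp C (Comp C (on_arr G (on_arr Q (\<epsilon> Y))) (z ?FGY)) (on_arr P (\<eta> ?GY))"
      unfolding transposed_mate_def by (rule comp_assoc[OF C P\<eta> z_in_Hom GQ\<epsilon>]) simp_all
    also have "\<dots> = Comp C (Comp C (z Y) (on_arr P (on_arr G (\<epsilon> Y)))) (on_arr P (\<eta> ?GY))"
      using z_nat[OF \<epsilon>_in_Hom] by simp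
    also have "\<dots> = Comp C (z Y) (Comp C (on_arr P (on_arr G (\<epsilon> Y))) (on_arr P (\<eta> ?GY)))"
      by (rule comp_assoc[OF C P\<eta> PG\<epsilon> z_in_Hom, symmetric]) simp_all
    also have "Comp C (on_arr P (on_arr G (\<epsilon> Y))) (on_arr P (\<eta> ?GY)) = Id C (on_obj P ?GY)"
      using functor_comp[OF P \<eta>_in_Hom G\<epsilon>] triangle_right[OF Y] by (simp add: functor_id[OF P])
    also have "Comp C (z Y) \<dots> = z Y"
      by (rule comp_id_right[OF C z_in_Hom]) simp_all
    finally show ?thesis .
  qed
  have "Comp D (on_arr Q (\<epsilon> Y)) ?v
      = Comp D (Comp D (on_arr Q (\<epsilon> Y)) (\<epsilon> (on_obj Q ?FGY))) (on_arr F ?k)"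
    unfolding mate_inverse_def by (rule comp_assoc[OF D Fk \<epsilon>_in_Hom Q\<epsilon>]) simp_all
  also have "\<dots> = Comp D (Comp D (\<epsilon> ?QY) (on_arr F (on_arr G (on_arr Q (\<epsilon> Y))))) (on_arr F ?k)"
    using \<epsilon>_nat[OF Q\<epsilon>] by simp
  also have "\<dots> = Comp D (\<epsilon> ?QY) (Comp D (on_arr F (on_arr G (on_arr Q (\<epsilon> Y)))) (on_arr F ?k))"
    by (rule comp_assoc[OF D Fk FGQ\<epsilon> \<epsilon>_in_Hom, symmetric]) simp_all
  also have "\<dots> = Comp D (\<epsilon> ?QY) (on_arr F (z Y))"
    using functor_comp[OF F k GQ\<epsilon>] GQ\<epsilon>_k by simp
  finally have eq: "Comp D (\<epsilon> ?QY) (on_arr F (z Y)) = Comp D (on_arr Q (\<epsilon> Y)) ?v" ..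
  have "Comp D (Comp D (on_arr Q (\<epsilon> Y)) ?v) (w ?GY) = Comp D (on_arr Q (\<epsilon> Y)) (Comp D ?v (w ?GY))"
    by (rule comp_assoc[OF D w_in_Hom v Q\<epsilon>, symmetric]) simp_all
  also have "\<dots> = on_arr Q (\<epsilon> Y)"
    unfolding vw by (rule comp_id_right[OF D Q\<epsilon>]) simp_all
  finally show ?thesis unfolding eq .
qed

lemma unit_equivariant:
  assumes X: "X \<in> Obj C" and \<sigma>: "\<sigma> \<in> Hom C (on_obj P X) X"
  shows "Comp C (Comp C (on_arr G (Comp D (on_arr F \<sigma>) (w X))) (z (on_obj F X))) (on_arr P (\<eta> X))
    = Comp C (\<eta> X) \<sigma>"
proof -
  note [simp] = X
  let ?FX = "on_obj F X" and ?FPX = "on_obj F (on_obj P X)"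
  have F\<sigma>: "on_arr F \<sigma> \<in> Hom D ?FPX ?FX" by (rule functor_arr[OF F \<sigma>]) simp_all
  have GF\<sigma>: "on_arr G (on_arr F \<sigma>) \<in> Hom C (on_obj G ?FPX) (on_obj G ?FX)"
    by (rule functor_arr[OF G F\<sigma>]) simp_all
  have Gw: "on_arr G (w X) \<in> Hom C (on_obj G (on_obj Q ?FX)) (on_obj G ?FPX)"
    by (rule functor_arr[OF G w_in_Hom]) simp_all
  have GF\<sigma>w: "on_arr G (Comp D (on_arr F \<sigma>) (w X)) = Comp C (on_arr G (on_arr F \<sigma>)) (on_arr G (w X))"
    by (rule functor_comp[OF G w_in_Hom F\<sigma>]) simp_all
  have GF\<sigma>_Gw: "Comp C (on_arr G (on_arr F \<sigma>)) (on_arr G (w X)) \<in> Hom C (on_obj G (on_obj Q ?FX)) (on_obj G ?FX)"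
    by (rule comp_in_Hom[OF C Gw GF\<sigma>]) simp_all
  have "Comp C (Comp C (Comp C (on_arr G (on_arr F \<sigma>)) (on_arr G (w X))) (z ?FX)) (on_arr P (\<eta> X))
      = Comp C (Comp C (on_arr G (on_arr F \<sigma>)) (on_arr G (w X))) (transposed_mate X)"
    unfolding transposed_mate_def
    by (rule comp_assoc[OF C P\<eta>_in_Hom z_in_Hom GF\<sigma>_Gw, symmetric]) simp_all
  also have "\<dots> = Comp C (on_arr G (on_arr F \<sigma>)) (Comp C (on_arr G (w X)) (transposed_mate X))"
    by (rule comp_assoc[OF C transposed_mate_in_Hom Gw GF\<sigma>, symmetric]) simp_all
  also have "\<dots> = Comp C (\<eta> X) \<sigma>"
    unfolding unit_compatible[OF X] using \<eta>_nat[OF \<sigma>] by simp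
  finally show ?thesis unfolding GF\<sigma>w .
qed

lemma counit_equivariant:
  assumes Y: "Y \<in> Obj D" and \<tau>: "\<tau> \<in> Hom D (on_obj Q Y) Y"
  shows "Comp D \<tau> (on_arr Q (\<epsilon> Y))
    = Comp D (\<epsilon> Y) (Comp D (on_arr F (Comp C (on_arr G \<tau>) (z Y))) (w (on_obj G Y)))"
proof -
  note [simp] = Y
  let ?GY = "on_obj G Y" and ?QY = "on_obj Q Y"
  have G\<tau>: "on_arr G \<tau> \<in> Hom C (on_obj G ?QY) ?GY" by (rule functor_arr[OF G \<tau>]) simp_all
  have FG\<tau>: "on_arr F (on_arr G \<tau>) \<in> Hom D (on_obj F (on_obj G ?QY)) (on_obj F ?GY)"
    by (rule functor_arr[OF F G\<tau>]) simp_all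
  have Fz: "on_arr F (z Y) \<in> Hom D (on_obj F (on_obj P ?GY)) (on_obj F (on_obj G ?QY))"
    by (rule functor_arr[OF F z_in_Hom]) simp_all
  have Fzw: "Comp D (on_arr F (z Y)) (w ?GY) \<in> Hom D (on_obj Q (on_obj F ?GY)) (on_obj F (on_obj G ?QY))"
    by (rule comp_in_Hom[OF D w_in_Hom Fz]) simp_all
  have "Comp D (on_arr F (Comp C (on_arr G \<tau>) (z Y))) (w ?GY)
      = Comp D (Comp D (on_arr F (on_arr G \<tau>)) (on_arr F (z Y))) (w ?GY)"
    using functor_comp[OF F z_in_Hom G\<tau>] by simp
  also have "\<dots> = Comp D (on_arr F (on_arr G \<tau>)) (Comp D (on_arr F (z Y)) (w ?GY))"
    by (rule comp_assoc[OF D w_in_Hom Fz FG\<tau>, symmetric]) simp_all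
  finally have "Comp D (\<epsilon> Y) (Comp D (on_arr F (Comp C (on_arr G \<tau>) (z Y))) (w ?GY))
      = Comp D (\<epsilon> Y) (Comp D (on_arr F (on_arr G \<tau>)) (Comp D (on_arr F (z Y)) (w ?GY)))"
    by simp
  also have "\<dots> = Comp D (Comp D (\<epsilon> Y) (on_arr F (on_arr G \<tau>))) (Comp D (on_arr F (z Y)) (w ?GY))"
    by (rule comp_assoc[OF D Fzw FG\<tau> \<epsilon>_in_Hom]) simp_all
  also have "\<dots> = Comp D (Comp D \<tau> (\<epsilon> ?QY)) (Comp D (on_arr F (z Y)) (w ?GY))"
    using \<epsilon>_nat[OF \<tau>] by simp
  also have "\<dots> = Comp D \<tau> (Comp D (\<epsilon> ?QY) (Comp D (on_arr F (z Y)) (w ?GY)))"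
    by (rule comp_assoc[OF D Fzw \<epsilon>_in_Hom \<tau>, symmetric]) simp_all
  also have "Comp D (\<epsilon> ?QY) (Comp D (on_arr F (z Y)) (w ?GY))
      = Comp D (Comp D (\<epsilon> ?QY) (on_arr F (z Y))) (w ?GY)"
    by (rule comp_assoc[OF D w_in_Hom Fz \<epsilon>_in_Hom]) simp_all
  also note counit_compatible[OF Y]
  finally show ?thesis ..
qed

text \<open>
  Equivariance is the only condition on \<open>\<eta>\<close> and \<open>\<epsilon>\<close> that is not already part of the given adjunction:
  forgetting anti-involutions is faithful, so equations between arrows can be checked underneath.
\<close>

theorem adjunction_lift:
  "adjunction (involutive C P) (involutive D Q) (involutive_lift D F w) (involutive_lift C G z)
     (\<eta> \<circ> fst) (\<epsilon> \<circ> fst)"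
proof -
  let ?F = "involutive_lift D F w" and ?G = "involutive_lift C G z"
  have F': "is_functor (involutive C P) (involutive D Q) ?F"
    by (rule functor_involutive_lift[OF P Q F PP w w_inv])
  have G': "is_functor (involutive D Q) (involutive C P) ?G"
    by (rule functor_involutive_lift[OF Q P G QQ z z_inv])
  have unit: "natural_transformation (involutive C P) (involutive C P) id_ftr (?G \<circ>\<^sub>F ?F) (\<eta> \<circ> fst)"
    unfolding natural_transformation_def
  proof (intro conjI ballI functor_id_ftr functor_comp_ftr[OF F' G'] category_involutive[OF P]; clarify)
    fix X \<sigma> assume "(X, \<sigma>) \<in> Obj (involutive C P)"
    then show "(\<eta> \<circ> fst) (X, \<sigma>)
        \<in> Hom (involutive C P) (on_obj id_ftr (X, \<sigma>)) (on_obj (?G \<circ>\<^sub>F ?F) (X, \<sigma>))"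
      by (simp add: id_ftr_def comp_ftr_def involutive_lift_def involutive_simps \<eta>_in_Hom
          unit_equivariant)
  next
    fix X \<sigma> Y \<rho> f
    assume "(X, \<sigma>) \<in> Obj (involutive C P)" "(Y, \<rho>) \<in> Obj (involutive C P)"
      "f \<in> Hom (involutive C P) (X, \<sigma>) (Y, \<rho>)"
    then show "Comp (involutive C P) ((\<eta> \<circ> fst) (Y, \<rho>)) (on_arr id_ftr f)
        = Comp (involutive C P) (on_arr (?G \<circ>\<^sub>F ?F) f) ((\<eta> \<circ> fst) (X, \<sigma>))"
      by (simp add: id_ftr_def comp_ftr_def involutive_lift_def involutive_simps \<eta>_nat)
  qed
  have counit: "natural_transformation (involutive D Q) (involutive D Q) (?F \<circ>\<^sub>F ?G) id_ftr (\<epsilon> \<circ> fst)"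
    unfolding natural_transformation_def
  proof (intro conjI ballI functor_id_ftr functor_comp_ftr[OF G' F'] category_involutive[OF Q]; clarify)
    fix Y \<tau> assume "(Y, \<tau>) \<in> Obj (involutive D Q)"
    then show "(\<epsilon> \<circ> fst) (Y, \<tau>)
        \<in> Hom (involutive D Q) (on_obj (?F \<circ>\<^sub>F ?G) (Y, \<tau>)) (on_obj id_ftr (Y, \<tau>))"
      by (simp add: id_ftr_def comp_ftr_def involutive_lift_def involutive_simps \<epsilon>_in_Hom
          counit_equivariant)
  next
    fix V \<tau> Y \<upsilon> g
    assume "(V, \<tau>) \<in> Obj (involutive D Q)" "(Y, \<upsilon>) \<in> Obj (involutive D Q)"
      "g \<in> Hom (involutive D Q) (V, \<tau>) (Y, \<upsilon>)"
    then show "Comp (involutive D Q) ((\<epsilon> \<circ> fst) (Y, \<upsilon>)) (on_arr (?F \<circ>\<^sub>F ?G) g)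
        = Comp (involutive D Q) (on_arr id_ftr g) ((\<epsilon> \<circ> fst) (V, \<tau>))"
      by (simp add: id_ftr_def comp_ftr_def involutive_lift_def involutive_simps \<epsilon>_nat)
  qed
  show ?thesis
    unfolding adjunction_def
  proof (intro conjI ballI F' G' unit counit; clarify)
    fix X \<sigma> assume "(X, \<sigma>) \<in> Obj (involutive C P)"
    then show "Comp (involutive D Q) ((\<epsilon> \<circ> fst) (on_obj ?F (X, \<sigma>))) (on_arr ?F ((\<eta> \<circ> fst) (X, \<sigma>)))
        = Id (involutive D Q) (on_obj ?F (X, \<sigma>))"
      by (simp add: involutive_lift_def involutive_simps triangle_left)
  next
    fix Y \<tau> assume "(Y, \<tau>) \<in> Obj (involutive D Q)"
    then show "Comp (involutive C P) (on_arr ?G ((\<epsilon> \<circ> fst) (Y, \<tau>))) ((\<eta> \<circ> fst) (on_obj ?G (Y, \<tau>)))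
        = Id (involutive C P) (on_obj ?G (Y, \<tau>))"
      by (simp add: involutive_lift_def involutive_simps triangle_right)
  qed
qed

end


section \<open>Opposite simplicial sets\<close>

lemma rev_Delta_in_Delta: "\<theta> \<in> Delta m n \<Longrightarrow> rev_Delta m n \<theta> \<in> Delta m n"
  by (auto simp: Delta_def rev_Delta_def mono_on_def intro!: diff_le_mono2)

lemma rev_Delta_rev_Delta:
  assumes "\<theta> \<in> Delta m n" shows "rev_Delta m n (rev_Delta m n \<theta>) = \<theta>"
proof
  fix i show "rev_Delta m n (rev_Delta m n \<theta>) i = \<theta> i"
    using assms by (cases "i \<le> m") (auto simp: Delta_def rev_Delta_def PiE_iff extensional_def)
qed

lemma rev_Delta_id: "rev_Delta n n (\<lambda>i\<in>{..n}. i) = (\<lambda>i\<in>{..n}. i)"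
  by (auto simp: rev_Delta_def fun_eq_iff)

lemma rev_Delta_compose:
  assumes "\<phi> \<in> Delta l m" "\<theta> \<in> Delta m n"
  shows "rev_Delta l n (compose {..l} \<theta> \<phi>) = compose {..l} (rev_Delta m n \<theta>) (rev_Delta l m \<phi>)"
  using assms by (auto simp: rev_Delta_def compose_def fun_eq_iff Delta_def PiE_iff)

lemma id_in_Delta: "(\<lambda>i\<in>{..n}. i) \<in> Delta n n"
  by (auto simp: Delta_def mono_on_def)

lemma compose_in_Delta:
  assumes "\<phi> \<in> Delta l m" "\<theta> \<in> Delta m n" shows "compose {..l} \<theta> \<phi> \<in> Delta l n"
  using assms by (auto simp: Delta_def mono_on_def compose_def PiE_iff)

lemma is_sset_op_sset:
  assumes K: "is_sset K" shows "is_sset (op_sset K)"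
  using K
  by (simp add: is_sset_def op_sset_def rev_Delta_in_Delta rev_Delta_id id_in_Delta
      rev_Delta_compose compose_in_Delta)

text \<open>
  Both records have the value \<open>undefined\<close> off \<open>Delta\<close>, which makes this an equality and not merely an
  isomorphism; an involution that is strict on objects is what the lifting principle asks for.
\<close>

lemma op_sset_op_sset:
  assumes K: "is_sset K" shows "op_sset (op_sset K) = K"
proof -
  have "act (op_sset (op_sset K)) = act K"
  proof (intro ext)
    fix m n \<theta> x
    show "act (op_sset (op_sset K)) m n \<theta> x = act K m n \<theta> x"
      using K by (cases "\<theta> \<in> Delta m n")
        (simp_all add: op_sset_def rev_Delta_in_Delta rev_Delta_rev_Delta is_sset_def)
  qed
  then show ?thesis by (simp add: op_sset_def)
qed

lemma is_sset_map_op_sset: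
  assumes "is_sset_map K L f" shows "is_sset_map (op_sset K) (op_sset L) f"
  using assms by (simp add: is_sset_map_def op_sset_def rev_Delta_in_Delta)

lemma functor_op_sSet:
  assumes "category (sSet :: ('s sset, 's sset_arr) cat)"
  shows "is_functor (sSet :: ('s sset, 's sset_arr) cat) sSet op_sSet"
  using assms
  by (auto simp: is_functor_def sSet_def op_sSet_def is_sset_op_sset is_sset_map_op_sset)
    (simp_all add: op_sset_def)


section \<open>Opposite simplicial categories\<close>

lemma op_scat_op_scat: "op_scat (op_scat X) = X"
  by (simp add: op_scat_def)

lemma idn_at_op_scat: "idn_at (op_scat X) n a = idn_at X n a"
  by (simp add: idn_at_def op_scat_def)

lemma is_scat_op_scat:
  assumes "is_scat X" shows "is_scat (op_scat X)"
  using assms unfolding is_scat_def idn_at_op_scat by (simp add: op_scat_def)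

lemma is_sfun_op_scat:
  assumes "is_sfun X Y (F, \<Phi>)" shows "is_sfun (op_scat X) (op_scat Y) (F, \<lambda>a b. \<Phi> b a)"
  using assms by (auto simp: is_sfun_def op_scat_def)

lemma functor_op_sCat:
  assumes "category (sCat :: (('o, 'h) scat, ('o, 'h) scat_arr) cat)"
  shows "is_functor (sCat :: (('o, 'h) scat, ('o, 'h) scat_arr) cat) sCat op_sCat"
  using assms
  by (auto simp: is_functor_def sCat_def op_sCat_def is_scat_op_scat is_sfun_op_scat)
    (auto simp: op_scat_def id_sfun_def comp_sfun_def fun_eq_iff)


section \<open>The homotopy coherent adjunction with anti-involutions\<close>


theorem theorem5p4:
  fixes \<CC> :: "('a usset, 'a usset_arr, 'a uscat, 'a uscat_arr) ftr"
    and \<eta> :: "'a usset \<Rightarrow> 'a usset_arr"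
    and \<epsilon> :: "'a uscat \<Rightarrow> 'a uscat_arr"
    and z :: "'a uscat \<Rightarrow> 'a usset_arr"
    and w :: "'a usset \<Rightarrow> 'a uscat_arr"
  assumes "adjunction sSet sCat \<CC> Nhc \<eta> \<epsilon>"
    and "natural_isomorphism sCat sSet (op_sSet \<circ>\<^sub>F Nhc) (Nhc \<circ>\<^sub>F op_sCat) z"
    and "natural_isomorphism sSet sCat (op_sCat \<circ>\<^sub>F \<CC>) (\<CC> \<circ>\<^sub>F op_sSet) w"
    and "\<forall>X\<in>Obj sCat. inverse_arrows sSet (op_sset (Nhc_obj X)) (Nhc_obj (op_scat X))
           (z X) (on_arr op_sSet (z (op_scat X)))"
    and "\<forall>A\<in>Obj sSet. inverse_arrows sCat (op_scat (on_obj \<CC> A)) (on_obj \<CC> (op_sset A))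
           (w A) (on_arr op_sCat (w (op_sset A)))"
    and "\<forall>A\<in>Obj sSet. inverse_arrows sCat (op_scat (on_obj \<CC> A)) (on_obj \<CC> (op_sset A))
           (w A)
           (Comp sCat (\<epsilon> (op_scat (on_obj \<CC> A)))
              (Comp sCat (on_arr \<CC> (z (on_obj \<CC> A)))
                 (on_arr \<CC> (on_arr op_sSet (\<eta> A)))))"
  shows "left_adjoint isSet isCat (involutive_lift sCat \<CC> w) (involutive_lift sSet Nhc z)"
proof -
  note adj = assms(1)
  have "is_functor sSet sCat \<CC>" using adj by (simp add: adjunction_def)
  \<comment> \<open>An adjunction contains the category axioms for both sides.\<close>
  note cats = functor_categories[OF this]
  have op: "on_obj op_sSet = op_sset" "on_obj op_sCat = op_scat" "on_obj Nhc = Nhc_obj"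
    by (simp_all add: op_sSet_def op_sCat_def Nhc_def)
  have "involutive_adjunction sSet sCat op_sSet op_sCat \<CC> Nhc \<eta> \<epsilon> z w"
  proof
    show "is_functor (sSet :: ('a usset, 'a usset_arr) cat) sSet op_sSet" by (rule functor_op_sSet[OF cats(1)])
    show "is_functor (sCat :: ('a uscat, 'a uscat_arr) cat) sCat op_sCat" by (rule functor_op_sCat[OF cats(2)])
    show "on_obj op_sSet (on_obj op_sSet A) = A" if "A \<in> Obj sSet" for A :: "'a usset"
      using that by (simp add: op op_sset_op_sset sSet_def)
    show "on_obj op_sCat (on_obj op_sCat X) = X" for X :: "'a uscat"
      by (simp add: op op_scat_op_scat)
  qed (use assms in \<open>simp_all add: op natural_isomorphism_def\<close>)
  then show ?thesis
    unfolding left_adjoint_def isSet_def isCat_def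
    using involutive_adjunction.adjunction_lift by blast
qed

end
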